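(* Let $\epsilon>0$ be a sufficiently small constant such that $M=1/\epsilon$ is an integer, and let $m=2/\epsilon$. Let $\gamma_1,\dots,\gamma_m\in[0,1]$ be real numbers, not all zero. Then \[\frac{-\sum_{i=1}^m \gamma_i^2M^{2i}+(1+2\epsilon)\sum_{i=1}^{m-1}\gamma_i\gamma_{i+1}M^{2i+1}}{\sum_{i=1}^m\gamma_iM^{2i}}<\frac{1}{M^{\sqrt{m}/4}}.\] *)

theory Defs
  imports Complex_Main
begin

end

theory Submission
  imports Defs "HOL-Analysis.Convex"
begin

text \<open>
  With \<open>x\<^sub>i = \<gamma>\<^sub>i M\<^sup>i\<close> the numerator is \<open>N = - \<Sum>x\<^sub>i\<^sup>2 + (1 + 2\<epsilon>) \<Sum>x\<^sub>i x\<^sub>i\<^sub>+\<^sub>1\<close>.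
  Put \<open>Q = \<Sum>x\<^sub>i\<^sup>2\<close> and \<open>s = \<surd>m / 4\<close>. If \<open>N\<close> is nonnegative, then \<open>N \<le> 2\<epsilon>Q\<close> and the energy
  \<open>\<Sum>(x\<^sub>i\<^sub>+\<^sub>1 - x\<^sub>i)\<^sup>2\<close> is at most \<open>4\<epsilon>Q\<close>. If the claim fails, then the bounds \<open>x\<^sub>i \<le> M\<^sup>i\<close> and
  \<open>x\<^sub>i M\<^sup>i \<le> N M\<^sup>s\<close> confine almost all of \<open>Q\<close> to a window of \<open>s + O(1)\<close> indices, to the left of
  which \<open>x\<close> is negligible. A Poincare inequality on this window bounds \<open>Q\<close> by roughly \<open>s\<^sup>2\<close>
  times the energy, that is by a constant below \<open>1\<close> times \<open>Q\<close>, which is absurd.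
\<close>

text \<open>Telescoping followed by Cauchy-Schwarz: the pointwise form of the Poincare
  inequality.\<close>

lemma power2_diff_le_energy:
  fixes x :: "nat \<Rightarrow> real"
  assumes "a \<le> i" "i \<le> n"
  shows "(x i - x a)\<^sup>2 \<le> real (i - a) * (\<Sum>j<n. (x (Suc j) - x j)\<^sup>2)"
proof -
  have "(x i - x a)\<^sup>2 = (\<Sum>j\<in>{a..<i}. x (Suc j) - x j)\<^sup>2"
    using assms by (simp add: sum_Suc_diff')
  also have "\<dots> \<le> real (i - a) * (\<Sum>j\<in>{a..<i}. (x (Suc j) - x j)\<^sup>2)"
    using sum_squared_le_sum_of_squares[of "\<lambda>j. x (Suc j) - x j" "{a..<i}"] by (simp add: mult.commute)
  also have "\<dots> \<le> real (i - a) * (\<Sum>j<n. (x (Suc j) - x j)\<^sup>2)"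
    using assms by (intro mult_left_mono sum_mono2) auto
  finally show ?thesis .
qed

text \<open>Expanding the squares counts each interior square twice and the last one once;
  \<open>x 0 = 0\<close> removes the left boundary term.\<close>

lemma energy_eq:
  fixes x :: "nat \<Rightarrow> real"
  assumes "x 0 = 0"
  shows "(\<Sum>i<n. (x (Suc i) - x i)\<^sup>2)
    = 2 * (\<Sum>i=1..n. (x i)\<^sup>2) - (x n)\<^sup>2 - 2 * (\<Sum>i<n. x i * x (Suc i))"
  using assms by (induction n) (auto simp: power2_eq_square algebra_simps)

text \<open>The contradiction behind the theorem, with the denominator eliminated: a sum of
  nonnegative terms dominates each term \<open>x i * real M ^ i\<close>, so failure of the claim
  yields \<open>N_ge\<close> for every index.\<close>

lemma quadratic_form_lower_bound_fails:
  fixes x :: "nat \<Rightarrow> real" and M :: nat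
  defines "n \<equiv> 2 * M"
  defines "Q \<equiv> \<Sum>i=1..n. (x i)\<^sup>2"
  defines "s \<equiv> sqrt (real n) / 4"
  defines "N \<equiv> - Q + (1 + 2 / real M) * (\<Sum>i<n. x i * x (Suc i))"
  assumes M: "2500 \<le> M" and x0: "x 0 = 0"
    and x_nonneg: "\<And>i. i \<in> {1..n} \<Longrightarrow> 0 \<le> x i"
    and x_le: "\<And>i. i \<in> {1..n} \<Longrightarrow> x i \<le> real M ^ i"
    and N_ge: "\<And>i. i \<in> {1..n} \<Longrightarrow> x i * real M ^ i * real M powr (- s) \<le> N"
    and Q_pos: "0 < Q"
  shows False
proof -
  define E where "E = (\<Sum>i<n. (x (Suc i) - x i)\<^sup>2)"
  define P where "P = (\<Sum>i<n. x i * x (Suc i))"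
  have Mpos: "0 < real M" using M by simp
  have E: "E = 2 * Q - (x n)\<^sup>2 - 2 * P"
    unfolding E_def Q_def P_def by (rule energy_eq[of x, OF x0])
  have E_nonneg: "0 \<le> E" unfolding E_def by (simp add: sum_nonneg)
  have PQ: "P \<le> Q" using E E_nonneg zero_le_power2[of "x n"] by linarith
  have N_le: "2 * N \<le> 4 / real M * Q - E"
  proof -
    have "2 * N = - E - (x n)\<^sup>2 + 4 / real M * P"
      unfolding N_def E P_def[symmetric] by (simp add: algebra_simps)
    moreover have "4 / real M * P \<le> 4 / real M * Q"
      using PQ by (intro mult_left_mono) auto
    ultimately show ?thesis using zero_le_power2[of "x n"] by linarith
  qed
  have N_nonneg: "0 \<le> N"
  proof -
    have "0 \<le> x 1 * real M ^ 1 * real M powr (- s)"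
      using x_nonneg[of 1] M by (simp add: n_def)
    also have "\<dots> \<le> N" using N_ge[of 1] M by (simp add: n_def)
    finally show ?thesis .
  qed
  have E_le: "E \<le> 4 / real M * Q" using N_le N_nonneg by linarith
  have N_le': "N \<le> 2 / real M * Q"
  proof -
    have "4 / real M * Q = 2 * (2 / real M * Q)" by simp
    then show ?thesis using N_le E_nonneg by linarith
  qed

  \<comment> \<open>The window starts after the least such \<open>a\<close>. For a > 0 minimality
    gives Q >= M^(2a+2), which makes x negligible up to \<open>a\<close>; Q < M^(2a+4) itself makes
    x negligible beyond \<open>a + w\<close>.\<close>
  have "\<exists>a. Q < real M ^ (2 * a + 4)"
  proof -
    obtain k where k: "Q < real M ^ k" using real_arch_pow[of "real M" Q] M by auto
    have "real M ^ k \<le> real M ^ (2 * k + 4)" using M by (intro power_increasing) auto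
    with k show ?thesis by (intro exI[of _ k]) linarith
  qed
  then obtain a where a: "Q < real M ^ (2 * a + 4)"
    and a_min: "\<And>b. b < a \<Longrightarrow> \<not> Q < real M ^ (2 * b + 4)"
    using exists_least_iff[of "\<lambda>a. Q < real M ^ (2 * a + 4)"] by blast
  \<comment> \<open>The offset 2 makes k > a + w imply k - s > a + 2, hence Q < M^(2(k-s)).\<close>
  define w where "w = nat \<lfloor>s\<rfloor> + 2"
  have s_nonneg: "0 \<le> s" by (simp add: s_def)
  have w_gt: "s + 1 < real w" and w_le: "real w \<le> s + 2"
    using s_nonneg by (auto simp: w_def) linarith+

  have left: "(x i)\<^sup>2 \<le> Q / (real M)\<^sup>2" if "i \<le> a" "i \<le> n" for i
  \<comment> \<open>Index 0 is separate because minimality says nothing when a = 0.\<close>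
  proof (cases "i = 0")
    case True
    then show ?thesis using x0 Q_pos by simp
  next
    case False
    then obtain b where b: "a = Suc b" using \<open>i \<le> a\<close> by (cases a) auto
    have "(x i)\<^sup>2 \<le> (real M ^ i)\<^sup>2"
      using x_nonneg[of i] x_le[of i] False that by (intro power_mono) auto
    also have "\<dots> \<le> (real M ^ a)\<^sup>2"
      using M that by (intro power_mono power_increasing) auto
    also have "\<dots> = real M ^ (2 * b + 4) / (real M)\<^sup>2"
      using Mpos by (simp add: b power_add power_mult power2_eq_square power4_eq_xxxx field_simps power_mult_distrib)
    also have "\<dots> \<le> Q / (real M)\<^sup>2"
      using a_min[of b] b by (intro divide_right_mono) auto
    finally show ?thesis .
  qed

  \<comment> \<open>Square x_k M^(k-s) <= N <= 2Q/M, then cancel one factor Q against M^(2(k-s)) >=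
    Q.\<close>
  have right: "(x k)\<^sup>2 \<le> 4 * Q / (real M)\<^sup>2" if "a + w < k" "k \<le> n" for k
  proof -
    have k: "k \<in> {1..n}" using that by auto
    have "x k * real M powr (real k - s) = x k * real M ^ k * real M powr (- s)"
      using Mpos by (simp add: powr_diff powr_minus powr_realpow divide_inverse)
    also have "\<dots> \<le> 2 / real M * Q" using N_ge[OF k] N_le' by linarith
    finally have "(x k * real M powr (real k - s))\<^sup>2 \<le> (2 / real M * Q)\<^sup>2"
      using x_nonneg[OF k] by (intro power_mono) auto
    moreover have "(real M powr (real k - s))\<^sup>2 = real M powr (2 * (real k - s))"
      using Mpos by (simp add: powr_powr flip: powr_realpow) (simp add: mult.commute)
    ultimately have "(x k)\<^sup>2 * real M powr (2 * (real k - s)) \<le> 4 * Q / (real M)\<^sup>2 * Q"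
      by (simp add: power_mult_distrib power_divide power2_eq_square[of Q])
    moreover have "Q \<le> real M powr (2 * (real k - s))"
    proof -
      have "Q \<le> real M powr real (2 * a + 4)" using a Mpos by (simp only: powr_realpow)
      also have "\<dots> \<le> real M powr (2 * (real k - s))"
        using M w_gt that by (intro powr_mono) auto
      finally show ?thesis .
    qed
    ultimately have "(x k)\<^sup>2 * Q \<le> 4 * Q / (real M)\<^sup>2 * Q"
      by (meson mult_left_mono order_trans zero_le_power2)
    then show ?thesis using Q_pos by (simp only: mult_le_cancel_right_pos)
  qed

  \<comment> \<open>The weights come from (u+v)^2 <= 3/2 u^2 + 3 v^2. Since w^2 is about M/8 and E
    <= 4Q/M, the window contributes about 3/4 Q in total; the symmetric weights 2 and 2 would give
    about Q and no contradiction.\<close>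
  define B where "B = 3 / 2 * real w * E + 3 * (Q / (real M)\<^sup>2)"
  have B_nonneg: "0 \<le> B" using E_nonneg Q_pos by (simp add: B_def)
  have mid: "(x i)\<^sup>2 \<le> B" if "a < i" "i \<le> a + w" "i \<le> n" for i
  proof -
    \<comment> \<open>Right side minus left side is half the square of
      \<open>x i - 3 * x a\<close>.\<close>
    have "(x i)\<^sup>2 \<le> 3 / 2 * (x i - x a)\<^sup>2 + 3 * (x a)\<^sup>2"
      using zero_le_power2[of "x i - 3 * x a"] by (simp add: power2_eq_square algebra_simps)
    moreover have "(x i - x a)\<^sup>2 \<le> real w * E"
    proof -
      have "(x i - x a)\<^sup>2 \<le> real (i - a) * E"
        unfolding E_def using that by (intro power2_diff_le_energy) auto
      also have "\<dots> \<le> real w * E" using that E_nonneg by (intro mult_right_mono) auto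
      finally show ?thesis .
    qed
    moreover have "(x a)\<^sup>2 \<le> Q / (real M)\<^sup>2" using that by (intro left) auto
    ultimately show ?thesis unfolding B_def by linarith
  qed

  have "Q \<le> (\<Sum>i=1..n. 4 * Q / (real M)\<^sup>2 + (if i \<in> {a<..a + w} then B else 0))"
    unfolding Q_def
  proof (rule sum_mono, fold Q_def)
    fix i assume i: "i \<in> {1..n}"
    have "0 \<le> Q / (real M)\<^sup>2" using Q_pos by simp
    then show "(x i)\<^sup>2 \<le> 4 * Q / (real M)\<^sup>2 + (if i \<in> {a<..a + w} then B else 0)"
      using left[of i] mid[of i] right[of i] i by (cases "i \<le> a"; cases "i \<le> a + w") auto
  qed
  also have "\<dots> = real n * (4 * Q / (real M)\<^sup>2) + real (card ({1..n} \<inter> {a<..a + w})) * B"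
    by (simp add: sum.distrib sum.If_cases Int_def)
  also have "\<dots> \<le> real n * (4 * Q / (real M)\<^sup>2) + real w * B"
  proof -
    have "card ({1..n} \<inter> {a<..a + w}) \<le> card {a<..a + w}" by (intro card_mono) auto
    then show ?thesis using B_nonneg by (simp add: mult_right_mono)
  qed
  also have "\<dots> = Q * (8 / real M + 3 * real w / (real M)\<^sup>2) + 3 / 2 * (real w)\<^sup>2 * E"
    using Mpos by (simp add: n_def B_def power2_eq_square field_simps)
  also have "\<dots> \<le> Q * (8 / real M + 3 * real w / (real M)\<^sup>2) + 3 / 2 * (real w)\<^sup>2 * (4 / real M * Q)"
    using E_le by (intro add_left_mono mult_left_mono) auto
  also have "\<dots> = Q * ((8 + 3 * real w / real M + 6 * (real w)\<^sup>2) / real M)"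
    using Mpos by (simp add: power2_eq_square field_simps)
  finally have "Q * 1 \<le> Q * ((8 + 3 * real w / real M + 6 * (real w)\<^sup>2) / real M)" by simp
  then have "1 \<le> (8 + 3 * real w / real M + 6 * (real w)\<^sup>2) / real M"
    using Q_pos by (simp only: mult_le_cancel_left_pos)
  then have final: "real M \<le> 8 + 3 * real w / real M + 6 * (real w)\<^sup>2"
    using Mpos by (simp add: field_simps)

  have s2: "s\<^sup>2 = real M / 8" by (simp add: s_def n_def power_divide)
  \<comment> \<open>M >= 2500 gives s^2 >= 312.5 > 17^2, so w <= s + 2 <= 19/17 s. Then 6 w^2 <=
    2166/2312 M, and \<open>final\<close> would force M below 175.\<close>
  have s17: "17 \<le> s"
    by (rule power2_le_imp_le) (use M s_nonneg in \<open>simp_all add: s2\<close>)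
  have "(real w)\<^sup>2 \<le> (19 / 17 * s)\<^sup>2"
    using w_le s17 by (intro power_mono) auto
  also have "\<dots> = 361 / 289 * (real M / 8)" by (simp add: power_mult_distrib s2 power_divide)
  finally have w2: "(real w)\<^sup>2 \<le> 361 / 2312 * real M" by simp
  have "real w \<le> real M"
  proof (rule power2_le_imp_le)
    have "(real w)\<^sup>2 \<le> real M * 1" using w2 Mpos by linarith
    also have "\<dots> \<le> real M * real M" using M by (intro mult_left_mono) auto
    finally show "(real w)\<^sup>2 \<le> (real M)\<^sup>2" by (simp add: power2_eq_square)
  qed simp
  then have "3 * real w / real M \<le> 3" using Mpos by (simp add: field_simps)
  then show False using final w2 M by linarith
qed

theorem theorem3p4:
  "\<exists>\<epsilon>\<^sub>0>0. \<forall>(\<epsilon>::real) (M::nat) (m::nat) (\<gamma>::nat \<Rightarrow> real).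
     0 < \<epsilon> \<longrightarrow> \<epsilon> < \<epsilon>\<^sub>0 \<longrightarrow> real M = 1 / \<epsilon> \<longrightarrow> real m = 2 / \<epsilon> \<longrightarrow>
     (\<forall>i\<in>{1..m}. \<gamma> i \<in> {0..1}) \<longrightarrow> (\<exists>i\<in>{1..m}. \<gamma> i \<noteq> 0) \<longrightarrow>
     (- (\<Sum>i=1..m. (\<gamma> i)\<^sup>2 * real M ^ (2 * i))
        + (1 + 2 * \<epsilon>) * (\<Sum>i=1..m - 1. \<gamma> i * \<gamma> (i + 1) * real M ^ (2 * i + 1)))
       / (\<Sum>i=1..m. \<gamma> i * real M ^ (2 * i))
     < 1 / real M powr (sqrt (real m) / 4)"
proof (intro exI[of _ "1 / 2500"] conjI allI impI)
  fix \<epsilon> :: real and M m :: nat and \<gamma> :: "nat \<Rightarrow> real"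
  assume \<epsilon>: "0 < \<epsilon>" "\<epsilon> < 1 / 2500" and M: "real M = 1 / \<epsilon>" and "real m = 2 / \<epsilon>"
    and \<gamma>: "\<forall>i\<in>{1..m}. \<gamma> i \<in> {0..1}" and nz: "\<exists>i\<in>{1..m}. \<gamma> i \<noteq> 0"
  then have "real m = real (2 * M)" by simp
  then have m: "m = 2 * M" by (simp only: of_nat_eq_iff)
  have \<epsilon>M: "\<epsilon> = 1 / real M" using M by simp
  have "2500 < real M" using \<epsilon> by (simp add: M field_simps)
  then have M2500: "2500 \<le> M" by simp
  have Mpos: "0 < real M" using M2500 by simp
  \<comment> \<open>The value of \<gamma> at 0 is arbitrary, so x is set to 0 there; this lets the
    product sum start at index 0 without changing it.\<close>
  define x where "x i = (if i = 0 then 0 else \<gamma> i * real M ^ i)" for i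
  define D where "D = (\<Sum>i=1..m. \<gamma> i * real M ^ (2 * i))"
  define Q where "Q = (\<Sum>i=1..m. (x i)\<^sup>2)"
  define N where "N = - Q + (1 + 2 / real M) * (\<Sum>i<m. x i * x (Suc i))"
  obtain j where j: "j \<in> {1..m}" "\<gamma> j \<noteq> 0" using nz by blast
  have D_ge: "\<gamma> i * real M ^ (2 * i) \<le> D" if "i \<in> {1..m}" for i
    unfolding D_def using that \<gamma> by (intro member_le_sum) auto
  have "0 < \<gamma> j * real M ^ (2 * j)" using j \<gamma> Mpos by force
  then have D_pos: "0 < D" using D_ge[OF j(1)] by linarith
  have Q_eq: "(\<Sum>i=1..m. (\<gamma> i)\<^sup>2 * real M ^ (2 * i)) = Q"
    unfolding Q_def by (intro sum.cong) (auto simp: x_def power_mult_distrib power_mult mult.commute simp flip: power_mult)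
  have P_eq: "(\<Sum>i=1..m - 1. \<gamma> i * \<gamma> (i + 1) * real M ^ (2 * i + 1)) = (\<Sum>i<m. x i * x (Suc i))"
  proof (rule sum.mono_neutral_cong_left)
    show "\<forall>i\<in>{..<m} - {1..m - 1}. x i * x (Suc i) = 0"
      by (auto simp: x_def)
    show "\<gamma> i * \<gamma> (i + 1) * real M ^ (2 * i + 1) = x i * x (Suc i)" if "i \<in> {1..m - 1}" for i
      using that by (simp add: x_def mult_2 power_add)
  qed auto
  have "N / D < 1 / real M powr (sqrt (real m) / 4)"
  proof (rule ccontr)
    assume "\<not> ?thesis"
    then have N_ge: "D * real M powr (- (sqrt (real m) / 4)) \<le> N"
      using D_pos by (simp add: powr_minus field_simps)
    have "x j \<noteq> 0" using j Mpos by (auto simp: x_def)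
    then have "0 < (x j)\<^sup>2" by simp
    also have "\<dots> \<le> Q" unfolding Q_def using j by (intro member_le_sum) auto
    finally have Q_pos: "0 < Q" .
    show False
    proof (rule quadratic_form_lower_bound_fails[OF M2500, of x, folded m, folded Q_def, folded N_def])
      show "x 0 = 0" by (simp add: x_def)
      fix i assume i: "i \<in> {1..m}"
      then show "0 \<le> x i" using \<gamma> by (simp add: x_def)
      show "x i \<le> real M ^ i"
        using i \<gamma> by (auto simp: x_def intro!: mult_left_le_one_le)
      have "x i * real M ^ i \<le> D"
        using D_ge[OF i] i by (simp add: x_def mult_2 power_add mult.assoc)
      then have "x i * real M ^ i * real M powr (- (sqrt (real m) / 4))
          \<le> D * real M powr (- (sqrt (real m) / 4))"
        by (intro mult_right_mono) auto
      with N_ge show "x i * real M ^ i * real M powr (- (sqrt (real m) / 4)) \<le> N" by linarith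
    qed (rule Q_pos)
  qed
  then show "(- (\<Sum>i=1..m. (\<gamma> i)\<^sup>2 * real M ^ (2 * i))
        + (1 + 2 * \<epsilon>) * (\<Sum>i=1..m - 1. \<gamma> i * \<gamma> (i + 1) * real M ^ (2 * i + 1)))
       / (\<Sum>i=1..m. \<gamma> i * real M ^ (2 * i))
     < 1 / real M powr (sqrt (real m) / 4)"
    unfolding Q_eq P_eq N_def D_def \<epsilon>M by simp
qed simp

end
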